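(* Let $\mathcal N$ be a relaxed data sound DPN, let $L$ be an event log (a multiset of log traces), and let $\kappa$ be a comparison-based cost function. Then equivalence up to constant comparison, $\sim_{cc}$, is a cost-based clustering of $L$ with respect to $\kappa$; that is, $\sim_{cc}$ is an equivalence relation on the log traces in $L$ such that for all log traces $\mathbf e,\mathbf e'\in L$ with $\mathbf e\sim_{cc}\mathbf e'$ one has $\kappa^{opt}_{\mathcal N}(\mathbf e)=\kappa^{opt}_{\mathcal N}(\mathbf e')$.
   Context: **Sorts and constraints.** Sorts are $\mathtt{bool},\mathtt{int},\mathtt{rat},\mathtt{string}$ with domains $\mathcal D(\cdot)$ the booleans, $\mathbb Z$, $\mathbb Q$, and a set $\mathbb S$ of strings. $V$ is a finite set of variables, each with a sort $sort(v)$. $V^r=\{v^r\mid v\in V\}$ and $V^w=\{v^w\mid v\in V\}$ are disjoint sets of annotated ("read"/"written") copies, with the same sorts. $\mathcal C(V)$ is the set of constraints: boolean combinations (via $\wedge,\neg$) of atoms, where atoms are boolean annotated variables, boolean constants, comparisons $n\ge n'$ of integer terms, $r\ge r'$ and $r>r'$ of rational terms, and equalities of string terms (other comparisons $=,\ne,<,\le$ and $\vee$ are used via standard equivalences). Integer (rational) terms are built from integer (rational) annotated variables and constants by $+$ and unary $-$; string terms are string annotated variables and constants. $Var(c)\subseteq V^r\cup V^w$ is the set of annotated variables occurring in $c$. **DPN.** A DPN is $\mathcal N=(P,T,F,\ell,A,V,guard)$ with non-empty disjoint finite sets $P$ (places) and $T$ (transitions), $F:(P\times T)\cup(T\times P)\to\mathbb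 N$, an injective labeling $\ell:T\to A\cup\{\tau\}$ ($A$ a finite set of activity labels, $\tau\notin A$ denoting a silent transition), and $guard:T\to\mathcal C(V)$. Put $read(t)=\{v\mid v^r\in Var(guard(t))\}$ and $write(t)=\{v\mid v^w\in Var(guard(t))\}$. A state is a pair $(M,\alpha)$ with a marking $M:P\to\mathbb N$ and a total assignment $\alpha$ with $\alpha(v)\in\mathcal D(sort(v))$. A transition firing is $(t,\beta)$ with $t\in T$ and $\beta$ a sort-respecting assignment of $Var(guard(t))$. We have $(M,\alpha)\xrightarrow{(t,\beta)}(M',\alpha')$ iff $\beta(v^r)=\alpha(v)$ for $v\in read(t)$; $\beta\models guard(t)$; $M(p)\ge F(p,t)$ for all $p$; $M'(p)=M(p)-F(p,t)+F(t,p)$ for all $p$; $\alpha'(v)=\beta(v^w)$ for $v\in write(t)$ and $\alpha'(v)=\alpha(v)$ otherwise. An initial state $(M_I,\alpha_0)$ and a final marking $M_F$ are fixed. A process run is a finite sequence of transition firings leading from $(M_I,\alpha_0)$ to some state $(M_F,\alpha_F)$. $\mathcal N$ is relaxed data sound if at least one process run exists. **Log traces and alignments.** An event is $(b,\alpha)$ with $b$ an activity label and $\alpha$ a partial sort-respecting assignment of $V$ with domain $\mathrm{dom}(\alpha)$; a log trace is a finite sequence of events. Let $\gg$ be a skip symbol. A move is a pair $(e,f)\neq(\gg,\gg)$ with $e$ an event or $\gg$ and $f$ a transition firing or $\gg$. For a sequence $\gamma$ of moves, the log projection $\gamma|_L$ (model projection $\gamma|_M$) is the sequence of first (second) components with all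 $\gg$ deleted. $\gamma$ is a complete alignment of $\mathbf e$ if $\gamma|_L=\mathbf e$ and $\gamma|_M$ is a process run. **Distance-based cost.** Let $P_L$ (on events), $P_M$ (on transition firings), $P_=$ (on pairs of an event and a transition firing) be penalty functions with values in $\mathbb N$ (the value $\infty$ being allowed for $P_=$). For a log trace $\mathbf e=e_1,\dots,e_m$ and a process run $\mathbf f=f_1,\dots,f_n$ with prefixes $\mathbf e|_i,\mathbf f|_j$, the edit distance $\delta$ is defined by $\delta(\epsilon,\epsilon)=0$, $\delta(\mathbf e|_{i+1},\epsilon)=P_L(e_{i+1})+\delta(\mathbf e|_i,\epsilon)$, $\delta(\epsilon,\mathbf f|_{j+1})=P_M(f_{j+1})+\delta(\epsilon,\mathbf f|_j)$, and $\delta(\mathbf e|_{i+1},\mathbf f|_{j+1})=\min\{\delta(\mathbf e|_i,\mathbf f|_j)+P_=(e_{i+1},f_{j+1}),\ P_L(e_{i+1})+\delta(\mathbf e|_i,\mathbf f|_{j+1}),\ P_M(f_{j+1})+\delta(\mathbf e|_{i+1},\mathbf f|_j)\}$. The distance-based cost function given by $P_L,P_M,P_=$ is $\kappa(\gamma)=\delta(\gamma|_L,\gamma|_M)$, and $\kappa^{opt}_{\mathcal N}(\mathbf e)$ is the minimum of $\kappa(\gamma)$ over all complete alignments $\gamma$ of $\mathbf e$. **Comparison-based.** A distance-based cost function is comparison-based if (1) $P_L(b,\alpha)$ does not depend on the values assigned by $\alpha$ (only on $b$ and $\mathrm{dom}(\alpha)$), and $P_M(t,\beta)$ does not depend on the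 values assigned by $\beta$; and (2) the value of $P_=((b,\alpha),(t,\beta))$ depends only on whether the condition $b=\ell(t)$, and the conditions $\alpha(v)=\beta(v^w)$ for $v\in\mathrm{dom}(\alpha)$, are satisfied or not (the latter counting as not satisfied when $v\notin write(t)$); i.e. two arguments with the same $\mathrm{dom}(\alpha)$ for which the same ones of these conditions hold have the same penalty. **Equivalence up to constant comparison.** A variable-to-constant atom is an expression $x\odot k$ with $\odot\in\{>,\ge,=\}$, $x\in V^r\cup V^w$, and $k$ a constant in $\mathbb Z$ or $\mathbb Q$ (atoms with $<,\le,\ne$ are read as negations of such atoms). A variable $v\in V$ is restricted to constant comparison if all atoms in guards of $\mathcal N$ that involve $v^r$ or $v^w$ are variable-to-constant atoms. For such $v$, $ats_v$ is the set of $v\odot k$ such that $v^r\odot k$ or $v^w\odot k$ is an atom of some guard of $\mathcal N$, and for values $u_1,u_2$ one writes $u_1\sim_{cc}^v u_2$ if for all $v\odot k\in ats_v$: $u_1\odot k$ holds iff $u_2\odot k$ holds. For event variable assignments, $\alpha\sim_{cc}\alpha'$ iff $\mathrm{dom}(\alpha)=\mathrm{dom}(\alpha')$ and for each $v\in\mathrm{dom}(\alpha)$ either $\alpha(v)=\alpha'(v)$, or $v$ is restricted to constant comparison and $\alpha(v)\sim_{cc}^v\alpha'(v)$. For events, $(b,\alpha)\sim_{cc}(b',\alpha')$ iff $b=b'$ and $\alpha\sim_{cc}\alpha'$. Two log traces are equivalent up to constant comparison, $\mathbf e\sim_{cc}\mathbf e'$, iff they have the same length and their $i$-th events are $\sim_{cc}$-equivalent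 for every $i$. *)

theory Defs
  imports Complex_Main "HOL-Library.FuncSet" "HOL-Library.Multiset" "HOL-Library.Extended_Nat"
begin

section \<open>Sorts, values and constraints\<close>

text \<open>The set of strings is an arbitrary (nonempty) set, given by the type variable \<^typ>\<open>'s\<close>.\<close>

datatype sort = SBool | SInt | SRat | SString

datatype 's val = BoolV (the_bool: bool) | IntV (the_int: int) | RatV (the_rat: rat) | StrV (the_str: 's)

fun sort_dom :: "sort \<Rightarrow> 's val set" where
  "sort_dom SBool = range BoolV"
| "sort_dom SInt = range IntV"
| "sort_dom SRat = range RatV"
| "sort_dom SString = range StrV"

datatype 'v avar = Rd (base: 'v) | Wr (base: 'v)

datatype (iterm_vars: 'x) iterm =
  IVar 'x | IConst int | IAdd "'x iterm" "'x iterm" | INeg "'x iterm"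

datatype (rterm_vars: 'x) rterm =
  RVar 'x | RConst rat | RAdd "'x rterm" "'x rterm" | RNeg "'x rterm"

datatype (sterm_vars: 'x, 's) sterm = SVar 'x | SConst 's

text \<open>All three of \<open>\<ge>\<close>, \<open>>\<close> and \<open>=\<close> are available as atomic comparisons of numeric terms, so
  that variable-to-constant atoms with any of them are atoms of guards. The comparisons
  \<open>\<le>\<close>, \<open><\<close> and \<open>\<noteq>\<close> are the negations of \<open>>\<close>, \<open>\<ge>\<close> and \<open>=\<close>.\<close>

datatype cmp = Ge | Gt | Eq

fun holds_cmp :: "cmp \<Rightarrow> 'a::linorder \<Rightarrow> 'a \<Rightarrow> bool" where
  "holds_cmp Ge x y \<longleftrightarrow> x \<ge> y"
| "holds_cmp Gt x y \<longleftrightarrow> x > y"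
| "holds_cmp Eq x y \<longleftrightarrow> x = y"

datatype (atom_vars: 'x, 's) atom =
  BVar 'x
| BConst bool
| ICmp cmp "'x iterm" "'x iterm"
| RCmp cmp "'x rterm" "'x rterm"
| SEq "('x, 's) sterm" "('x, 's) sterm"

datatype (atoms: 'b) bexp = Atom 'b | Conj "'b bexp" "'b bexp" | Neg "'b bexp"

type_synonym ('v, 's) constr = "('v avar, 's) atom bexp"

definition constr_vars :: "('v, 's) constr \<Rightarrow> 'v avar set" where
  "constr_vars c = (\<Union>a\<in>atoms c. atom_vars a)"

definition avars_of_sort :: "'v set \<Rightarrow> ('v \<Rightarrow> sort) \<Rightarrow> sort \<Rightarrow> 'v avar set" where
  "avars_of_sort V srt s = {x. base x \<in> V \<and> srt (base x) = s}"

fun well_sorted_atom :: "'v set \<Rightarrow> ('v \<Rightarrow> sort) \<Rightarrow> ('v avar, 's) atom \<Rightarrow> bool" where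
  "well_sorted_atom V srt (BVar x) \<longleftrightarrow> x \<in> avars_of_sort V srt SBool"
| "well_sorted_atom V srt (BConst b) \<longleftrightarrow> True"
| "well_sorted_atom V srt (ICmp c n n') \<longleftrightarrow>
     iterm_vars n \<union> iterm_vars n' \<subseteq> avars_of_sort V srt SInt"
| "well_sorted_atom V srt (RCmp c r r') \<longleftrightarrow>
     rterm_vars r \<union> rterm_vars r' \<subseteq> avars_of_sort V srt SRat"
| "well_sorted_atom V srt (SEq s s') \<longleftrightarrow>
     sterm_vars s \<union> sterm_vars s' \<subseteq> avars_of_sort V srt SString"

definition constraints :: "'v set \<Rightarrow> ('v \<Rightarrow> sort) \<Rightarrow> ('v, 's) constr set" where
  "constraints V srt = {c. \<forall>a\<in>atoms c. well_sorted_atom V srt a}"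

fun eval_iterm :: "('x \<Rightarrow> 's val) \<Rightarrow> 'x iterm \<Rightarrow> int" where
  "eval_iterm \<beta> (IVar x) = the_int (\<beta> x)"
| "eval_iterm \<beta> (IConst k) = k"
| "eval_iterm \<beta> (IAdd n n') = eval_iterm \<beta> n + eval_iterm \<beta> n'"
| "eval_iterm \<beta> (INeg n) = - eval_iterm \<beta> n"

fun eval_rterm :: "('x \<Rightarrow> 's val) \<Rightarrow> 'x rterm \<Rightarrow> rat" where
  "eval_rterm \<beta> (RVar x) = the_rat (\<beta> x)"
| "eval_rterm \<beta> (RConst k) = k"
| "eval_rterm \<beta> (RAdd r r') = eval_rterm \<beta> r + eval_rterm \<beta> r'"
| "eval_rterm \<beta> (RNeg r) = - eval_rterm \<beta> r"

fun eval_sterm :: "('x \<Rightarrow> 's val) \<Rightarrow> ('x, 's) sterm \<Rightarrow> 's" where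
  "eval_sterm \<beta> (SVar x) = the_str (\<beta> x)"
| "eval_sterm \<beta> (SConst k) = k"

fun sat_atom :: "('x \<Rightarrow> 's val) \<Rightarrow> ('x, 's) atom \<Rightarrow> bool" where
  "sat_atom \<beta> (BVar x) \<longleftrightarrow> the_bool (\<beta> x)"
| "sat_atom \<beta> (BConst b) \<longleftrightarrow> b"
| "sat_atom \<beta> (ICmp c n n') \<longleftrightarrow> holds_cmp c (eval_iterm \<beta> n) (eval_iterm \<beta> n')"
| "sat_atom \<beta> (RCmp c r r') \<longleftrightarrow> holds_cmp c (eval_rterm \<beta> r) (eval_rterm \<beta> r')"
| "sat_atom \<beta> (SEq s s') \<longleftrightarrow> eval_sterm \<beta> s = eval_sterm \<beta> s'"

fun sat :: "('x \<Rightarrow> 's val) \<Rightarrow> ('x, 's) atom bexp \<Rightarrow> bool" where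
  "sat \<beta> (Atom a) \<longleftrightarrow> sat_atom \<beta> a"
| "sat \<beta> (Conj c d) \<longleftrightarrow> sat \<beta> c \<and> sat \<beta> d"
| "sat \<beta> (Neg c) \<longleftrightarrow> \<not> sat \<beta> c"


section \<open>Data Petri nets\<close>

text \<open>Places and transitions are disjoint sets of nodes; \<open>flow\<close> is only ever used on
  place-transition and transition-place pairs. The label \<^term>\<open>None\<close> is the silent label.\<close>

record ('n, 'a, 'v, 's) dpn =
  places :: "'n set"
  transitions :: "'n set"
  flow :: "'n \<Rightarrow> 'n \<Rightarrow> nat"
  labeling :: "'n \<Rightarrow> 'a option"
  activities :: "'a set"
  vars :: "'v set"
  vsort :: "'v \<Rightarrow> sort"
  guard :: "'n \<Rightarrow> ('v, 's) constr"
  init_marking :: "'n \<Rightarrow> nat"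
  init_assign :: "'v \<Rightarrow> 's val"
  final_marking :: "'n \<Rightarrow> nat"

definition markings :: "('n, 'a, 'v, 's) dpn \<Rightarrow> ('n \<Rightarrow> nat) set" where
  "markings N = places N \<rightarrow>\<^sub>E UNIV"

definition assignments :: "('n, 'a, 'v, 's) dpn \<Rightarrow> ('v \<Rightarrow> 's val) set" where
  "assignments N = (\<Pi>\<^sub>E v\<in>vars N. sort_dom (vsort N v))"

definition is_dpn :: "('n, 'a, 'v, 's) dpn \<Rightarrow> bool" where
  "is_dpn N \<longleftrightarrow>
     finite (places N) \<and> places N \<noteq> {} \<and>
     finite (transitions N) \<and> transitions N \<noteq> {} \<and>
     places N \<inter> transitions N = {} \<and>
     finite (activities N) \<and>
     labeling N \<in> transitions N \<rightarrow> insert None (Some ` activities N) \<and>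
     inj_on (labeling N) (transitions N) \<and>
     finite (vars N) \<and>
     guard N \<in> transitions N \<rightarrow> constraints (vars N) (vsort N) \<and>
     init_marking N \<in> markings N \<and>
     init_assign N \<in> assignments N \<and>
     final_marking N \<in> markings N"

definition read :: "('n, 'a, 'v, 's) dpn \<Rightarrow> 'n \<Rightarrow> 'v set" where
  "read N t = {v. Rd v \<in> constr_vars (guard N t)}"

definition "write" :: "('n, 'a, 'v, 's) dpn \<Rightarrow> 'n \<Rightarrow> 'v set" where
  "write N t = {v. Wr v \<in> constr_vars (guard N t)}"

type_synonym ('n, 'v, 's) state = "('n \<Rightarrow> nat) \<times> ('v \<Rightarrow> 's val)"

type_synonym ('n, 'v, 's) firing = "'n \<times> ('v avar \<Rightarrow> 's val)"

definition firings :: "('n, 'a, 'v, 's) dpn \<Rightarrow> ('n, 'v, 's) firing set" where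
  "firings N = {(t, \<beta>). t \<in> transitions N \<and>
     \<beta> \<in> (\<Pi>\<^sub>E x\<in>constr_vars (guard N t). sort_dom (vsort N (base x)))}"

text \<open>The subtraction on \<^typ>\<open>nat\<close> below does not truncate, since enough tokens are required.\<close>

fun step :: "('n, 'a, 'v, 's) dpn \<Rightarrow> ('n, 'v, 's) state \<Rightarrow> ('n, 'v, 's) firing
    \<Rightarrow> ('n, 'v, 's) state \<Rightarrow> bool" where
  "step N (M, \<alpha>) (t, \<beta>) (M', \<alpha>') \<longleftrightarrow>
     M \<in> markings N \<and> \<alpha> \<in> assignments N \<and>
     (t, \<beta>) \<in> firings N \<and>
     M' \<in> markings N \<and> \<alpha>' \<in> assignments N \<and>
     (\<forall>v\<in>read N t. \<beta> (Rd v) = \<alpha> v) \<and>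
     sat \<beta> (guard N t) \<and>
     (\<forall>p\<in>places N. M p \<ge> flow N p t) \<and>
     (\<forall>p\<in>places N. M' p = M p - flow N p t + flow N t p) \<and>
     (\<forall>v\<in>vars N. \<alpha>' v = (if v \<in> write N t then \<beta> (Wr v) else \<alpha> v))"

fun steps :: "('n, 'a, 'v, 's) dpn \<Rightarrow> ('n, 'v, 's) state \<Rightarrow> ('n, 'v, 's) firing list
    \<Rightarrow> ('n, 'v, 's) state \<Rightarrow> bool" where
  "steps N s [] s' \<longleftrightarrow> s' = s"
| "steps N s (f # fs) s' \<longleftrightarrow> (\<exists>s''. step N s f s'' \<and> steps N s'' fs s')"

definition process_run :: "('n, 'a, 'v, 's) dpn \<Rightarrow> ('n, 'v, 's) firing list \<Rightarrow> bool" where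
  "process_run N fs \<longleftrightarrow>
     (\<exists>\<alpha>\<^sub>F. steps N (init_marking N, init_assign N) fs (final_marking N, \<alpha>\<^sub>F))"

definition relaxed_data_sound :: "('n, 'a, 'v, 's) dpn \<Rightarrow> bool" where
  "relaxed_data_sound N \<longleftrightarrow> (\<exists>fs. process_run N fs)"


section \<open>Log traces, alignments and cost\<close>

type_synonym ('a, 'v, 's) event = "'a \<times> ('v \<rightharpoonup> 's val)"

definition events :: "('n, 'a, 'v, 's) dpn \<Rightarrow> ('a, 'v, 's) event set" where
  "events N = {(b, \<alpha>). b \<in> activities N \<and> dom \<alpha> \<subseteq> vars N \<and>
     (\<forall>v u. \<alpha> v = Some u \<longrightarrow> u \<in> sort_dom (vsort N v))}"

abbreviation log_traces :: "('n, 'a, 'v, 's) dpn \<Rightarrow> ('a, 'v, 's) event list set" where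
  "log_traces N \<equiv> lists (events N)"

text \<open>In a move, the skip symbol is \<^term>\<open>None\<close>.\<close>

type_synonym ('n, 'a, 'v, 's) move =
  "('a, 'v, 's) event option \<times> ('n, 'v, 's) firing option"

definition moves :: "('n, 'a, 'v, 's) dpn \<Rightarrow> ('n, 'a, 'v, 's) move set" where
  "moves N = {(x, y). x \<in> insert None (Some ` events N) \<and>
     y \<in> insert None (Some ` firings N)} - {(None, None)}"

definition log_proj :: "('n, 'a, 'v, 's) move list \<Rightarrow> ('a, 'v, 's) event list" where
  "log_proj \<gamma> = List.map_filter fst \<gamma>"

definition model_proj :: "('n, 'a, 'v, 's) move list \<Rightarrow> ('n, 'v, 's) firing list" where
  "model_proj \<gamma> = List.map_filter snd \<gamma>"

definition complete_alignment ::
    "('n, 'a, 'v, 's) dpn \<Rightarrow> ('a, 'v, 's) event list \<Rightarrow> ('n, 'a, 'v, 's) move list \<Rightarrow> bool" where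
  "complete_alignment N e \<gamma> \<longleftrightarrow>
     \<gamma> \<in> lists (moves N) \<and> log_proj \<gamma> = e \<and> process_run N (model_proj \<gamma>)"

text \<open>\<open>edit_dist P\<^sub>L P\<^sub>M P\<^sub>E e f i j\<close> is the edit distance between the prefix of \<open>e\<close> of length \<open>i\<close>
  and the prefix of \<open>f\<close> of length \<open>j\<close>.\<close>

fun edit_dist :: "('e \<Rightarrow> nat) \<Rightarrow> ('f \<Rightarrow> nat) \<Rightarrow> ('e \<Rightarrow> 'f \<Rightarrow> enat)
    \<Rightarrow> 'e list \<Rightarrow> 'f list \<Rightarrow> nat \<Rightarrow> nat \<Rightarrow> enat" where
  "edit_dist P\<^sub>L P\<^sub>M P\<^sub>E e f 0 0 = 0"
| "edit_dist P\<^sub>L P\<^sub>M P\<^sub>E e f (Suc i) 0 = enat (P\<^sub>L (e ! i)) + edit_dist P\<^sub>L P\<^sub>M P\<^sub>E e f i 0"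
| "edit_dist P\<^sub>L P\<^sub>M P\<^sub>E e f 0 (Suc j) = enat (P\<^sub>M (f ! j)) + edit_dist P\<^sub>L P\<^sub>M P\<^sub>E e f 0 j"
| "edit_dist P\<^sub>L P\<^sub>M P\<^sub>E e f (Suc i) (Suc j) =
     Min {edit_dist P\<^sub>L P\<^sub>M P\<^sub>E e f i j + P\<^sub>E (e ! i) (f ! j),
          enat (P\<^sub>L (e ! i)) + edit_dist P\<^sub>L P\<^sub>M P\<^sub>E e f i (Suc j),
          enat (P\<^sub>M (f ! j)) + edit_dist P\<^sub>L P\<^sub>M P\<^sub>E e f (Suc i) j}"

definition distance :: "('e \<Rightarrow> nat) \<Rightarrow> ('f \<Rightarrow> nat) \<Rightarrow> ('e \<Rightarrow> 'f \<Rightarrow> enat)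
    \<Rightarrow> 'e list \<Rightarrow> 'f list \<Rightarrow> enat" where
  "distance P\<^sub>L P\<^sub>M P\<^sub>E e f = edit_dist P\<^sub>L P\<^sub>M P\<^sub>E e f (length e) (length f)"

text \<open>A cost function is only relevant on complete alignments of log traces.\<close>

definition distance_based ::
    "('n, 'a, 'v, 's) dpn \<Rightarrow> (('a, 'v, 's) event \<Rightarrow> nat) \<Rightarrow> (('n, 'v, 's) firing \<Rightarrow> nat)
      \<Rightarrow> (('a, 'v, 's) event \<Rightarrow> ('n, 'v, 's) firing \<Rightarrow> enat)
      \<Rightarrow> (('n, 'a, 'v, 's) move list \<Rightarrow> enat) \<Rightarrow> bool" where
  "distance_based N P\<^sub>L P\<^sub>M P\<^sub>E \<kappa> \<longleftrightarrow>
     (\<forall>e\<in>log_traces N. \<forall>\<gamma>. complete_alignment N e \<gamma> \<longrightarrow>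
        \<kappa> \<gamma> = distance P\<^sub>L P\<^sub>M P\<^sub>E (log_proj \<gamma>) (model_proj \<gamma>))"

text \<open>Any nonempty set of extended naturals has a minimum, which is its infimum; the set below is
  nonempty for every log trace of a relaxed data sound net.\<close>

definition opt_cost :: "('n, 'a, 'v, 's) dpn \<Rightarrow> (('n, 'a, 'v, 's) move list \<Rightarrow> enat)
    \<Rightarrow> ('a, 'v, 's) event list \<Rightarrow> enat" where
  "opt_cost N \<kappa> e = (INF \<gamma>\<in>{\<gamma>. complete_alignment N e \<gamma>}. \<kappa> \<gamma>)"

definition writes_value :: "('n, 'a, 'v, 's) dpn \<Rightarrow> ('v \<rightharpoonup> 's val) \<Rightarrow> ('n, 'v, 's) firing
    \<Rightarrow> 'v \<Rightarrow> bool" where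
  "writes_value N \<alpha> f v \<longleftrightarrow> v \<in> write N (fst f) \<and> \<alpha> v = Some (snd f (Wr v))"

definition comparison_based_penalties ::
    "('n, 'a, 'v, 's) dpn \<Rightarrow> (('a, 'v, 's) event \<Rightarrow> nat) \<Rightarrow> (('n, 'v, 's) firing \<Rightarrow> nat)
      \<Rightarrow> (('a, 'v, 's) event \<Rightarrow> ('n, 'v, 's) firing \<Rightarrow> enat) \<Rightarrow> bool" where
  "comparison_based_penalties N P\<^sub>L P\<^sub>M P\<^sub>E \<longleftrightarrow>
     (\<forall>b \<alpha> \<alpha>'. (b, \<alpha>) \<in> events N \<and> (b, \<alpha>') \<in> events N \<and> dom \<alpha> = dom \<alpha>' \<longrightarrow>
        P\<^sub>L (b, \<alpha>) = P\<^sub>L (b, \<alpha>')) \<and>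
     (\<forall>t \<beta> \<beta>'. (t, \<beta>) \<in> firings N \<and> (t, \<beta>') \<in> firings N \<longrightarrow> P\<^sub>M (t, \<beta>) = P\<^sub>M (t, \<beta>')) \<and>
     (\<forall>b \<alpha> t \<beta> b' \<alpha>' t' \<beta>'.
        (b, \<alpha>) \<in> events N \<and> (t, \<beta>) \<in> firings N \<and> (b', \<alpha>') \<in> events N \<and> (t', \<beta>') \<in> firings N \<and>
        dom \<alpha> = dom \<alpha>' \<and>
        (Some b = labeling N t \<longleftrightarrow> Some b' = labeling N t') \<and>
        (\<forall>v\<in>dom \<alpha>. writes_value N \<alpha> (t, \<beta>) v \<longleftrightarrow> writes_value N \<alpha>' (t', \<beta>') v) \<longrightarrow>
        P\<^sub>E (b, \<alpha>) (t, \<beta>) = P\<^sub>E (b', \<alpha>') (t', \<beta>'))"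

definition comparison_based ::
    "('n, 'a, 'v, 's) dpn \<Rightarrow> (('n, 'a, 'v, 's) move list \<Rightarrow> enat) \<Rightarrow> bool" where
  "comparison_based N \<kappa> \<longleftrightarrow>
     (\<exists>P\<^sub>L P\<^sub>M P\<^sub>E. distance_based N P\<^sub>L P\<^sub>M P\<^sub>E \<kappa> \<and> comparison_based_penalties N P\<^sub>L P\<^sub>M P\<^sub>E)"


section \<open>Equivalence up to constant comparison\<close>

text \<open>If the constant is on the left-hand side, the comparison is turned around; for instance,
  \<open>k \<ge> x\<close> is \<open>x \<le> k\<close>, i.e. the negation of \<open>x > k\<close>.\<close>

fun turned :: "cmp \<Rightarrow> cmp" where
  "turned Ge = Gt"
| "turned Gt = Ge"
| "turned Eq = Eq"

lemma holds_cmp_turned: "holds_cmp c k x \<longleftrightarrow> (holds_cmp (turned c) x k \<longleftrightarrow> c = Eq)"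
  by (cases c) auto

fun var_const_atom :: "('x, 's) atom \<Rightarrow> ('x \<times> cmp \<times> 's val) option" where
  "var_const_atom (ICmp c (IVar x) (IConst k)) = Some (x, c, IntV k)"
| "var_const_atom (ICmp c (IConst k) (IVar x)) = Some (x, turned c, IntV k)"
| "var_const_atom (RCmp c (RVar x) (RConst k)) = Some (x, c, RatV k)"
| "var_const_atom (RCmp c (RConst k) (RVar x)) = Some (x, turned c, RatV k)"
| "var_const_atom _ = None"

fun holds_val_cmp :: "cmp \<Rightarrow> 's val \<Rightarrow> 's val \<Rightarrow> bool" where
  "holds_val_cmp c (IntV u) (IntV k) \<longleftrightarrow> holds_cmp c u k"
| "holds_val_cmp c (RatV u) (RatV k) \<longleftrightarrow> holds_cmp c u k"
| "holds_val_cmp c _ _ \<longleftrightarrow> False"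

definition restricted_to_cc :: "('n, 'a, 'v, 's) dpn \<Rightarrow> 'v \<Rightarrow> bool" where
  "restricted_to_cc N v \<longleftrightarrow>
     (\<forall>t\<in>transitions N. \<forall>a\<in>atoms (guard N t).
        Rd v \<in> atom_vars a \<or> Wr v \<in> atom_vars a \<longrightarrow> var_const_atom a \<noteq> None)"

text \<open>A pair \<open>(c, k)\<close> represents the comparison \<open>v c k\<close>.\<close>

definition ats :: "('n, 'a, 'v, 's) dpn \<Rightarrow> 'v \<Rightarrow> (cmp \<times> 's val) set" where
  "ats N v = {(c, k). \<exists>t\<in>transitions N. \<exists>a\<in>atoms (guard N t).
     var_const_atom a = Some (Rd v, c, k) \<or> var_const_atom a = Some (Wr v, c, k)}"

definition cc_val :: "('n, 'a, 'v, 's) dpn \<Rightarrow> 'v \<Rightarrow> 's val \<Rightarrow> 's val \<Rightarrow> bool" where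
  "cc_val N v u\<^sub>1 u\<^sub>2 \<longleftrightarrow> (\<forall>(c, k)\<in>ats N v. holds_val_cmp c u\<^sub>1 k \<longleftrightarrow> holds_val_cmp c u\<^sub>2 k)"

definition cc_assign :: "('n, 'a, 'v, 's) dpn \<Rightarrow> ('v \<rightharpoonup> 's val) \<Rightarrow> ('v \<rightharpoonup> 's val) \<Rightarrow> bool" where
  "cc_assign N \<alpha> \<alpha>' \<longleftrightarrow> dom \<alpha> = dom \<alpha>' \<and>
     (\<forall>v\<in>dom \<alpha>. \<alpha> v = \<alpha>' v \<or>
        restricted_to_cc N v \<and> cc_val N v (the (\<alpha> v)) (the (\<alpha>' v)))"

definition cc_event :: "('n, 'a, 'v, 's) dpn \<Rightarrow> ('a, 'v, 's) event \<Rightarrow> ('a, 'v, 's) event \<Rightarrow> bool" where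
  "cc_event N x y \<longleftrightarrow> fst x = fst y \<and> cc_assign N (snd x) (snd y)"

definition cc_trace ::
    "('n, 'a, 'v, 's) dpn \<Rightarrow> ('a, 'v, 's) event list \<Rightarrow> ('a, 'v, 's) event list \<Rightarrow> bool" where
  "cc_trace N = list_all2 (cc_event N)"

definition cost_based_clustering ::
    "('n, 'a, 'v, 's) dpn \<Rightarrow> (('n, 'a, 'v, 's) move list \<Rightarrow> enat) \<Rightarrow> ('a, 'v, 's) event list multiset
      \<Rightarrow> (('a, 'v, 's) event list \<Rightarrow> ('a, 'v, 's) event list \<Rightarrow> bool) \<Rightarrow> bool" where
  "cost_based_clustering N \<kappa> L R \<longleftrightarrow>
     equiv (set_mset L) {(e, e'). e \<in># L \<and> e' \<in># L \<and> R e e'} \<and>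
     (\<forall>e\<in>#L. \<forall>e'\<in>#L. R e e' \<longrightarrow> opt_cost N \<kappa> e = opt_cost N \<kappa> e')"

end

theory Submission
  imports Defs "HOL-Combinatorics.Transposition"
begin

text \<open>By symmetry it suffices to turn a process run \<open>f\<close> into a process run that is at most as far
  from \<open>e'\<close> as \<open>f\<close> is from \<open>e\<close>. In an optimal edit script each firing of \<open>f\<close> is matched with at most
  one event of \<open>e\<close>; if the event assigns \<open>u\<close> to \<open>v\<close>, and \<open>u'\<close> in \<open>e'\<close>, swap \<open>u\<close> and \<open>u'\<close> in the value
  that the firing writes to \<open>v\<close>. The same comparisons between observed and written values hold
  afterwards; merely replacing \<open>u\<close> by \<open>u'\<close> would not suffice, since a firing already writing \<open>u'\<close>
  would newly agree with the event. Propagating the new values through the reads gives a run,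
  as guards cannot distinguish \<open>u\<close> from \<open>u'\<close>.\<close>

section \<open>Values that the guards cannot tell apart\<close>

definition cc_eq :: "('n, 'a, 'v, 's) dpn \<Rightarrow> 'v \<Rightarrow> 's val \<Rightarrow> 's val \<Rightarrow> bool" where
  "cc_eq N v u u' \<longleftrightarrow> u = u' \<or> restricted_to_cc N v \<and> cc_val N v u u'"

lemma cc_eq_refl [simp]: "cc_eq N v u u"
  by (simp add: cc_eq_def)

lemma cc_eq_sym: "cc_eq N v u u' \<Longrightarrow> cc_eq N v u' u"
  by (auto simp: cc_eq_def cc_val_def)

lemma cc_eq_trans: "cc_eq N v u u' \<Longrightarrow> cc_eq N v u' u'' \<Longrightarrow> cc_eq N v u u''"
  by (auto simp: cc_eq_def cc_val_def)

text \<open>A transposition moves only the two swapped values, and each of them to the other, so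
  equivalence of the two keeps every value inside its class.\<close>

lemma cc_eq_transpose: "cc_eq N v a a' \<Longrightarrow> cc_eq N v u (Transposition.transpose a a' u)"
  by (auto simp: Transposition.transpose_def intro: cc_eq_sym)

text \<open>Rephrasing \<open>cc_assign\<close> through a relation on plain values reduces the
  equivalence laws to pointwise ones, and lets the same relation be used for states and
  firings.\<close>

lemma cc_assign_iff:
  "cc_assign N \<alpha> \<alpha>' \<longleftrightarrow>
    dom \<alpha> = dom \<alpha>' \<and> (\<forall>v\<in>dom \<alpha>. cc_eq N v (the (\<alpha> v)) (the (\<alpha>' v)))"
proof -
  have "\<alpha> v = \<alpha>' v \<longleftrightarrow> the (\<alpha> v) = the (\<alpha>' v)" if "dom \<alpha> = dom \<alpha>'" "v \<in> dom \<alpha>" for v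
    using that by (metis domD option.sel)
  then show ?thesis
    unfolding cc_assign_def cc_eq_def by blast
qed

lemma cc_event_refl: "cc_event N x x"
  by (simp add: cc_event_def cc_assign_iff)

lemma cc_event_sym: "cc_event N x y \<Longrightarrow> cc_event N y x"
  by (auto simp: cc_event_def cc_assign_iff intro: cc_eq_sym)

lemma cc_event_trans: "cc_event N x y \<Longrightarrow> cc_event N y z \<Longrightarrow> cc_event N x z"
  unfolding cc_event_def cc_assign_iff by (metis cc_eq_trans)

lemma cc_trace_sym: "cc_trace N x y \<Longrightarrow> cc_trace N y x"
  unfolding cc_trace_def by (simp add: list_all2_conv_all_nth cc_event_sym)

lemma equivp_cc_trace: "equivp (cc_trace N)"
proof (rule equivpI)
  show "reflp (cc_trace N)"
    unfolding cc_trace_def by (simp add: reflp_def list_all2_refl cc_event_refl)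
  show "symp (cc_trace N)"
    by (simp add: symp_def cc_trace_sym)
  show "transp (cc_trace N)"
    unfolding cc_trace_def transp_def by (blast intro: list_all2_trans cc_event_trans)
qed


section \<open>Guards and runs under changed values\<close>

lemma eval_iterm_cong: "(\<And>x. x \<in> iterm_vars n \<Longrightarrow> \<beta> x = \<beta>' x) \<Longrightarrow> eval_iterm \<beta> n = eval_iterm \<beta>' n"
  by (induction n) auto

lemma eval_rterm_cong: "(\<And>x. x \<in> rterm_vars n \<Longrightarrow> \<beta> x = \<beta>' x) \<Longrightarrow> eval_rterm \<beta> n = eval_rterm \<beta>' n"
  by (induction n) auto

lemma eval_sterm_cong: "(\<And>x. x \<in> sterm_vars n \<Longrightarrow> \<beta> x = \<beta>' x) \<Longrightarrow> eval_sterm \<beta> n = eval_sterm \<beta>' n"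
  by (cases n) auto

lemma sat_atom_cong:
  assumes "\<And>x. x \<in> atom_vars a \<Longrightarrow> \<beta> x = \<beta>' x"
  shows "sat_atom \<beta> a = sat_atom \<beta>' a"
proof (cases a)
  case (ICmp c m n)
  with assms eval_iterm_cong[of m \<beta> \<beta>'] eval_iterm_cong[of n \<beta> \<beta>'] show ?thesis by simp
next
  case (RCmp c m n)
  with assms eval_rterm_cong[of m \<beta> \<beta>'] eval_rterm_cong[of n \<beta> \<beta>'] show ?thesis by simp
next
  case (SEq m n)
  with assms eval_sterm_cong[of m \<beta> \<beta>'] eval_sterm_cong[of n \<beta> \<beta>'] show ?thesis by simp
qed (use assms in auto)

lemma sat_cong:
  "(\<And>a. a \<in> atoms c \<Longrightarrow> sat_atom \<beta> a = sat_atom \<beta>' a) \<Longrightarrow> sat \<beta> c = sat \<beta>' c"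
  by (induction c) auto

lemma var_const_atom_vars: "var_const_atom a = Some (x, c, k) \<Longrightarrow> atom_vars a = {x}"
  by (induction a rule: var_const_atom.induct) auto

lemma holds_cmp_turned_cong:
  "holds_cmp (turned c) x k = holds_cmp (turned c) x' k \<Longrightarrow> holds_cmp c k x = holds_cmp c k x'"
  by (cases c) auto

text \<open>The sort assumptions reconcile two views of an atom: \<open>holds_val_cmp\<close> is
  false on mismatched constructors, whereas \<open>sat_atom\<close> applies a selector such as
  \<open>the_int\<close>, whose value is unspecified there. A constant on the left only negates the
  turned comparison or leaves it as it is, which does not affect agreement.\<close>

lemma sat_var_const_atom_cong:
  assumes "var_const_atom a = Some (x, c, k)" "well_sorted_atom V srt a"
    and "\<beta> x \<in> sort_dom (srt (base x))" "\<beta>' x \<in> sort_dom (srt (base x))"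
    and "holds_val_cmp c (\<beta> x) k \<longleftrightarrow> holds_val_cmp c (\<beta>' x) k"
  shows "sat_atom \<beta> a = sat_atom \<beta>' a"
  using assms
  by (induction a rule: var_const_atom.induct)
    (auto simp: avars_of_sort_def simp del: turned.simps intro!: holds_cmp_turned_cong)

text \<open>Each atom is of one of two kinds. If it is not a variable-to-constant atom, none of its
  variables is restricted, so both assignments agree on them exactly. Otherwise its comparison
  belongs to \<open>ats\<close> of its only variable and is respected by
  \<open>cc_val\<close>.\<close>

lemma sat_guard_cc_eq:
  assumes "is_dpn N" "(t, \<beta>) \<in> firings N" "(t, \<beta>') \<in> firings N"
    and eq: "\<And>x. x \<in> constr_vars (guard N t) \<Longrightarrow> cc_eq N (base x) (\<beta> x) (\<beta>' x)"
  shows "sat \<beta> (guard N t) = sat \<beta>' (guard N t)"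
proof (rule sat_cong)
  fix a assume a: "a \<in> atoms (guard N t)"
  have t: "t \<in> transitions N"
    using assms(2) by (simp add: firings_def)
  have ws: "well_sorted_atom (vars N) (vsort N) a"
    using assms(1) t a by (auto simp: is_dpn_def constraints_def Pi_def)
  have sub: "atom_vars a \<subseteq> constr_vars (guard N t)"
    using a by (auto simp: constr_vars_def)
  show "sat_atom \<beta> a = sat_atom \<beta>' a"
  proof (cases "var_const_atom a")
    case None
    show ?thesis
    proof (rule sat_atom_cong)
      fix x assume x: "x \<in> atom_vars a"
      have "\<not> restricted_to_cc N (base x)"
        unfolding restricted_to_cc_def using None t a x by (cases x) force+
      with eq[of x] x sub show "\<beta> x = \<beta>' x"
        by (auto simp: cc_eq_def)
    qed
  next
    case (Some xck)
    obtain x c k where xck: "var_const_atom a = Some (x, c, k)"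
      using Some by (cases xck) auto
    then have x: "x \<in> constr_vars (guard N t)"
      using sub var_const_atom_vars by fastforce
    have "(c, k) \<in> ats N (base x)"
      using xck t a by (cases x) (auto simp: ats_def)
    with eq[OF x] have "holds_val_cmp c (\<beta> x) k \<longleftrightarrow> holds_val_cmp c (\<beta>' x) k"
      by (auto simp: cc_eq_def cc_val_def)
    moreover have "\<beta> x \<in> sort_dom (vsort N (base x))" "\<beta>' x \<in> sort_dom (vsort N (base x))"
      using assms(2,3) x by (auto simp: firings_def)
    ultimately show ?thesis
      using sat_var_const_atom_cong[OF xck ws] by blast
  qed
qed

section \<open>Replaying a run after its written values have changed\<close>

lemma constr_vars_guard_vars:
  assumes "is_dpn N" "t \<in> transitions N" "x \<in> constr_vars (guard N t)"
  shows "base x \<in> vars N"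
proof -
  obtain a where a: "a \<in> atoms (guard N t)" "x \<in> atom_vars a"
    using assms(3) by (auto simp: constr_vars_def)
  have "well_sorted_atom (vars N) (vsort N) a"
    using assms(1,2) a by (auto simp: is_dpn_def constraints_def Pi_def)
  with a(2) show ?thesis
    by (cases a) (auto simp: avars_of_sort_def)
qed

text \<open>Reads are deliberately left unrelated: \<open>g\<close> only prescribes what to write,
  and need neither satisfy its guard nor fit any state.\<close>

definition cc_firing :: "('n, 'a, 'v, 's) dpn \<Rightarrow> ('n, 'v, 's) firing \<Rightarrow> ('n, 'v, 's) firing \<Rightarrow> bool"
  where "cc_firing N f g \<longleftrightarrow> f \<in> firings N \<and> g \<in> firings N \<and> fst f = fst g \<and>
    (\<forall>v\<in>write N (fst f). cc_eq N v (snd f (Wr v)) (snd g (Wr v)))"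

definition same_writes :: "('n, 'a, 'v, 's) dpn \<Rightarrow> ('n, 'v, 's) firing \<Rightarrow> ('n, 'v, 's) firing \<Rightarrow> bool"
  where "same_writes N f g \<longleftrightarrow> f \<in> firings N \<and> g \<in> firings N \<and> fst f = fst g \<and>
    (\<forall>v\<in>write N (fst f). snd f (Wr v) = snd g (Wr v))"

text \<open>The transition stays the same, so the markings do too. Only the guard is at stake, and
  it sees equivalent values: the reads come from equivalent states, the writes from equivalent
  firings.\<close>

lemma step_cc_firing:
  assumes "is_dpn N" "step N (M, \<alpha>) f (M', \<alpha>')" "cc_firing N f g"
    and \<alpha>\<^sub>1: "\<alpha>\<^sub>1 \<in> assignments N" "\<And>v. v \<in> vars N \<Longrightarrow> cc_eq N v (\<alpha> v) (\<alpha>\<^sub>1 v)"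
  obtains h \<alpha>\<^sub>1' where "same_writes N g h" "step N (M, \<alpha>\<^sub>1) h (M', \<alpha>\<^sub>1')"
    "\<alpha>\<^sub>1' \<in> assignments N" "\<And>v. v \<in> vars N \<Longrightarrow> cc_eq N v (\<alpha>' v) (\<alpha>\<^sub>1' v)"
proof -
  obtain t \<beta> \<gamma> where fg: "f = (t, \<beta>)" "g = (t, \<gamma>)"
    using assms(3) by (cases f, cases g) (auto simp: cc_firing_def)
  \<comment> \<open>Reads follow the new state, writes follow \<open>g\<close>. Restricting the
    function to the variables of the guard makes it extensional, as \<open>firings\<close>
    demands.\<close>
  define \<beta>\<^sub>1 where
    "\<beta>\<^sub>1 = (\<lambda>x\<in>constr_vars (guard N t). case x of Rd v \<Rightarrow> \<alpha>\<^sub>1 v | Wr v \<Rightarrow> \<gamma> (Wr v))"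
  define \<alpha>\<^sub>1' where "\<alpha>\<^sub>1' = (\<lambda>v\<in>vars N. if v \<in> write N t then \<gamma> (Wr v) else \<alpha>\<^sub>1 v)"
  have F: "(t, \<beta>) \<in> firings N" "(t, \<gamma>) \<in> firings N"
    using assms(3) fg by (auto simp: cc_firing_def)
  then have t: "t \<in> transitions N"
    by (simp add: firings_def)
  have \<gamma>: "\<gamma> x \<in> sort_dom (vsort N (base x))" if "x \<in> constr_vars (guard N t)" for x
    using F(2) that by (auto simp: firings_def)
  have \<alpha>\<^sub>1_sort: "\<alpha>\<^sub>1 v \<in> sort_dom (vsort N v)" if "v \<in> vars N" for v
    using \<alpha>\<^sub>1(1) that by (auto simp: assignments_def)
  have F1: "(t, \<beta>\<^sub>1) \<in> firings N"
    using t \<gamma> \<alpha>\<^sub>1_sort constr_vars_guard_vars[OF assms(1) t]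
    by (fastforce simp: firings_def \<beta>\<^sub>1_def split: avar.splits)
  have W: "\<beta>\<^sub>1 (Wr v) = \<gamma> (Wr v)" if "v \<in> write N t" for v
    using that by (simp add: \<beta>\<^sub>1_def write_def)
  have A: "\<alpha>\<^sub>1' \<in> assignments N"
    using \<gamma> \<alpha>\<^sub>1_sort by (fastforce simp: assignments_def \<alpha>\<^sub>1'_def write_def)
  have st: "\<beta> (Rd v) = \<alpha> v" if "v \<in> read N t" for v
    using assms(2) that fg by simp
  have cw: "cc_eq N v (\<beta> (Wr v)) (\<gamma> (Wr v))" if "v \<in> write N t" for v
    using assms(3) that fg by (auto simp: cc_firing_def)
  have "cc_eq N (base x) (\<beta> x) (\<beta>\<^sub>1 x)" if "x \<in> constr_vars (guard N t)" for x
    using that st cw \<alpha>\<^sub>1(2) constr_vars_guard_vars[OF assms(1) t that]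
    by (cases x) (auto simp: \<beta>\<^sub>1_def read_def write_def)
  then have "sat \<beta> (guard N t) = sat \<beta>\<^sub>1 (guard N t)"
    by (rule sat_guard_cc_eq[OF assms(1) F(1) F1])
  then have "step N (M, \<alpha>\<^sub>1) (t, \<beta>\<^sub>1) (M', \<alpha>\<^sub>1')"
    using assms(2) fg F1 A W \<alpha>\<^sub>1(1)
    by (simp add: \<alpha>\<^sub>1'_def) (simp add: \<beta>\<^sub>1_def read_def)
  moreover have "same_writes N g (t, \<beta>\<^sub>1)"
    using F F1 W fg by (simp add: same_writes_def)
  moreover have "cc_eq N v (\<alpha>' v) (\<alpha>\<^sub>1' v)" if "v \<in> vars N" for v
    using that assms(2) fg \<alpha>\<^sub>1(2)[OF that] cw by (auto simp: \<alpha>\<^sub>1'_def)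
  ultimately show thesis
    using that A by blast
qed

text \<open>Equivalence of the two current assignments is the invariant. The starting assignments
  must be allowed to differ, since after a changed write the replay continues from a different
  state.\<close>

lemma steps_cc_firing:
  assumes "is_dpn N" "steps N (M, \<alpha>) fs (M', \<alpha>')" "list_all2 (cc_firing N) fs gs"
    and "\<alpha>\<^sub>1 \<in> assignments N" "\<And>v. v \<in> vars N \<Longrightarrow> cc_eq N v (\<alpha> v) (\<alpha>\<^sub>1 v)"
  shows "\<exists>hs \<alpha>\<^sub>1'. list_all2 (same_writes N) gs hs \<and> steps N (M, \<alpha>\<^sub>1) hs (M', \<alpha>\<^sub>1')"
  using assms(2-)
proof (induction fs arbitrary: M \<alpha> gs \<alpha>\<^sub>1)
  case Nil
  then show ?case
    by (auto intro: exI[of _ "[]"])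
next
  case (Cons f fs)
  obtain g gs' where gs: "gs = g # gs'" "cc_firing N f g" "list_all2 (cc_firing N) fs gs'"
    using Cons.prems(2) by (auto simp: list_all2_Cons1)
  obtain M2 \<alpha>2 where s: "step N (M, \<alpha>) f (M2, \<alpha>2)" "steps N (M2, \<alpha>2) fs (M', \<alpha>')"
    using Cons.prems(1) by auto
  obtain h \<alpha>3 where h: "same_writes N g h" "step N (M, \<alpha>\<^sub>1) h (M2, \<alpha>3)"
    "\<alpha>3 \<in> assignments N" "\<And>v. v \<in> vars N \<Longrightarrow> cc_eq N v (\<alpha>2 v) (\<alpha>3 v)"
    using step_cc_firing[OF assms(1) s(1) gs(2) Cons.prems(3,4)] by blast
  obtain hs \<alpha>\<^sub>1' where "list_all2 (same_writes N) gs' hs" "steps N (M2, \<alpha>3) hs (M', \<alpha>\<^sub>1')"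
    using Cons.IH[OF s(2) gs(3) h(3,4)] by blast
  with h gs(1) have "list_all2 (same_writes N) gs (h # hs)" "steps N (M, \<alpha>\<^sub>1) (h # hs) (M', \<alpha>\<^sub>1')"
    by auto
  then show ?case
    by blast
qed

text \<open>A process run prescribes the final marking but no final assignment, so the replay may
  end with other values.\<close>

lemma process_run_cc_firing:
  assumes "is_dpn N" "process_run N fs" "list_all2 (cc_firing N) fs gs"
  obtains hs where "list_all2 (same_writes N) gs hs" "process_run N hs"
proof -
  obtain \<alpha>\<^sub>F where "steps N (init_marking N, init_assign N) fs (final_marking N, \<alpha>\<^sub>F)"
    using assms(2) by (auto simp: process_run_def)
  moreover have "init_assign N \<in> assignments N"
    using assms(1) by (simp add: is_dpn_def)
  ultimately obtain hs \<alpha>\<^sub>F' where "list_all2 (same_writes N) gs hs"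
    "steps N (init_marking N, init_assign N) hs (final_marking N, \<alpha>\<^sub>F')"
    using steps_cc_firing[OF assms(1) _ assms(3) _ cc_eq_refl] by blast
  then show thesis
    by (intro that) (auto simp: process_run_def)
qed


section \<open>Edit distance\<close>

text \<open>The recursion for \<open>i\<close> and \<open>j\<close> inspects only positions below
  them. Hence a firing at position \<open>j\<close> or later can be altered without disturbing this
  distance.\<close>

lemma edit_dist_cong:
  assumes "\<And>k. k < i \<Longrightarrow> P\<^sub>L (e ! k) = P\<^sub>L (e' ! k)"
    and "\<And>l. l < j \<Longrightarrow> P\<^sub>M (f ! l) = P\<^sub>M (f' ! l)"
    and "\<And>k l. k < i \<Longrightarrow> l < j \<Longrightarrow> P\<^sub>E (e ! k) (f ! l) = P\<^sub>E (e' ! k) (f' ! l)"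
  shows "edit_dist P\<^sub>L P\<^sub>M P\<^sub>E e f i j = edit_dist P\<^sub>L P\<^sub>M P\<^sub>E e' f' i j"
  using assms
proof (induction P\<^sub>L P\<^sub>M P\<^sub>E e f i j rule: edit_dist.induct)
  case (4 P\<^sub>L P\<^sub>M P\<^sub>E e f i j)
  then show ?case
    by (simp del: Min_insert)
qed simp_all

text \<open>The penalty of a pair depends on the firing only through the transition and the written
  values, so reads may be left untouched here.\<close>

definition swap_writes :: "('n, 'a, 'v, 's) dpn \<Rightarrow> ('v \<rightharpoonup> 's val) \<Rightarrow> ('v \<rightharpoonup> 's val)
    \<Rightarrow> ('n, 'v, 's) firing \<Rightarrow> ('n, 'v, 's) firing" where
  "swap_writes N \<alpha> \<alpha>' f = (fst f, \<lambda>x\<in>constr_vars (guard N (fst f)). case x of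
     Rd v \<Rightarrow> snd f x
   | Wr v \<Rightarrow> if v \<in> dom \<alpha> then Transposition.transpose (the (\<alpha> v)) (the (\<alpha>' v)) (snd f x)
            else snd f x)"

text \<open>Both swapped values are observed for the same variable by events of the net, so the swap
  respects sorts; equivalence is \<open>cc_eq_transpose\<close>.\<close>

lemma cc_firing_swap_writes:
  assumes "(b, \<alpha>) \<in> events N" "(b, \<alpha>') \<in> events N" "cc_assign N \<alpha> \<alpha>'" "f \<in> firings N"
  shows "cc_firing N f (swap_writes N \<alpha> \<alpha>' f)"
proof -
  have A: "the (\<alpha> v) \<in> sort_dom (vsort N v)" "the (\<alpha>' v) \<in> sort_dom (vsort N v)" if "\<alpha> v \<noteq> None" for v
  proof -
    have "v \<in> dom \<alpha>" "v \<in> dom \<alpha>'"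
      using assms(3) that by (auto simp: cc_assign_def)
    then obtain u u' where "\<alpha> v = Some u" "\<alpha>' v = Some u'"
      by blast
    then show "the (\<alpha> v) \<in> sort_dom (vsort N v)" "the (\<alpha>' v) \<in> sort_dom (vsort N v)"
      using assms(1,2) by (auto simp: events_def)
  qed
  have B: "snd f x \<in> sort_dom (vsort N (base x))" if "x \<in> constr_vars (guard N (fst f))" for x
    using assms(4) that by (auto simp: firings_def)
  have "fst f \<in> transitions N"
    using assms(4) by (auto simp: firings_def)
  moreover have "snd (swap_writes N \<alpha> \<alpha>' f) x \<in> sort_dom (vsort N (base x))"
    if x: "x \<in> constr_vars (guard N (fst f))" for x
    using x B[OF x] A[of "base x"]
    by (cases x) (simp_all add: swap_writes_def Transposition.transpose_def domIff)
  ultimately have "swap_writes N \<alpha> \<alpha>' f \<in> firings N"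
    unfolding firings_def by (auto simp: swap_writes_def)
  moreover have "cc_eq N v (snd f (Wr v)) (snd (swap_writes N \<alpha> \<alpha>' f) (Wr v))"
    if "v \<in> write N (fst f)" for v
    using that assms(3)
    by (auto simp: swap_writes_def write_def cc_assign_iff intro!: cc_eq_transpose)
  ultimately show ?thesis
    using assms(4) by (simp add: cc_firing_def swap_writes_def)
qed

text \<open>The transposition is injective and sends the old observed value to the new one, so
  agreement is neither lost nor gained.\<close>

lemma writes_value_swap_writes:
  assumes "dom \<alpha> = dom \<alpha>'" "v \<in> dom \<alpha>"
  shows "writes_value N \<alpha>' (swap_writes N \<alpha> \<alpha>' f) v \<longleftrightarrow> writes_value N \<alpha> f v"
proof -
  obtain u u' where "\<alpha> v = Some u" "\<alpha>' v = Some u'"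
    using assms by (metis domD)
  then show ?thesis
    by (auto simp: writes_value_def swap_writes_def write_def Transposition.transpose_def dom_def)
qed

text \<open>Equivalent events share label and domain. For firings of one transition, the only
  condition left to check for \<open>P\<^sub>E\<close> is thus which observed values are
  written.\<close>

lemma comparison_based_penaltiesD:
  assumes "comparison_based_penalties N P\<^sub>L P\<^sub>M P\<^sub>E"
  shows "\<lbrakk>x \<in> events N; y \<in> events N; cc_event N x y\<rbrakk> \<Longrightarrow> P\<^sub>L x = P\<^sub>L y"
    and "\<lbrakk>f \<in> firings N; g \<in> firings N; fst f = fst g\<rbrakk> \<Longrightarrow> P\<^sub>M f = P\<^sub>M g"
    and "\<lbrakk>x \<in> events N; y \<in> events N; cc_event N x y; f \<in> firings N; g \<in> firings N; fst f = fst g;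
      \<And>v. v \<in> dom (snd x) \<Longrightarrow> writes_value N (snd x) f v \<longleftrightarrow> writes_value N (snd y) g v\<rbrakk>
      \<Longrightarrow> P\<^sub>E x f = P\<^sub>E y g"
proof -
  obtain b \<alpha> b' \<alpha>' where xy: "x = (b, \<alpha>)" "y = (b', \<alpha>')"
    by (cases x, cases y)
  obtain t \<beta> t' \<beta>' where fg: "f = (t, \<beta>)" "g = (t', \<beta>')"
    by (cases f, cases g)
  note P = assms[unfolded comparison_based_penalties_def]
  show "\<lbrakk>x \<in> events N; y \<in> events N; cc_event N x y\<rbrakk> \<Longrightarrow> P\<^sub>L x = P\<^sub>L y"
    using P[THEN conjunct1, rule_format, of b \<alpha> \<alpha>'] by (simp add: xy cc_event_def cc_assign_def)
  show "\<lbrakk>f \<in> firings N; g \<in> firings N; fst f = fst g\<rbrakk> \<Longrightarrow> P\<^sub>M f = P\<^sub>M g"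
    using P[THEN conjunct2, THEN conjunct1, rule_format, of t \<beta> \<beta>'] by (simp add: fg)
  show "\<lbrakk>x \<in> events N; y \<in> events N; cc_event N x y; f \<in> firings N; g \<in> firings N; fst f = fst g;
      \<And>v. v \<in> dom (snd x) \<Longrightarrow> writes_value N (snd x) f v \<longleftrightarrow> writes_value N (snd y) g v\<rbrakk>
      \<Longrightarrow> P\<^sub>E x f = P\<^sub>E y g"
    using P[THEN conjunct2, THEN conjunct2, rule_format, of b \<alpha> t \<beta> b' \<alpha>' t' \<beta>']
    by (simp add: xy fg cc_event_def cc_assign_def)
qed

text \<open>The induction follows an optimal edit script backwards: whichever alternative attains
  the minimum for \<open>e\<close> and \<open>f\<close> is imitated for \<open>e'\<close> and
  \<open>g\<close>. Keeping \<open>g\<close> related to all of \<open>f\<close>, not just to the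
  prefix, leaves a firing at position \<open>j\<close> to be replaced when needed.\<close>

lemma cc_trace_edit_dist:
  assumes cb: "comparison_based_penalties N P\<^sub>L P\<^sub>M P\<^sub>E"
    and cc: "cc_trace N e e'" and e: "e \<in> log_traces N" and e': "e' \<in> log_traces N"
    and f: "f \<in> lists (firings N)"
    and "i \<le> length e" "j \<le> length f"
  shows "\<exists>g. list_all2 (cc_firing N) f g \<and>
    edit_dist P\<^sub>L P\<^sub>M P\<^sub>E e' g i j \<le> edit_dist P\<^sub>L P\<^sub>M P\<^sub>E e f i j"
proof -
  let ?d = "edit_dist P\<^sub>L P\<^sub>M P\<^sub>E"
  note D = comparison_based_penaltiesD[OF cb]
  have ev: "e ! k \<in> events N" "e' ! k \<in> events N" "cc_event N (e ! k) (e' ! k)" if "k < length e" for k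
    using that e e' cc by (auto simp: cc_trace_def list_all2_conv_all_nth in_lists_conv_set)
  have PL: "P\<^sub>L (e' ! k) = P\<^sub>L (e ! k)" if "k < length e" for k
    using D(1) ev[OF that] by metis
  have PM: "P\<^sub>M (g ! l) = P\<^sub>M (f ! l)" if "list_all2 (cc_firing N) f g" "l < length f" for g l
    using D(2) list_all2_nthD[OF that] unfolding cc_firing_def by metis
  have refl: "list_all2 (cc_firing N) f f"
    using f by (auto simp: list_all2_conv_all_nth cc_firing_def in_lists_conv_set)
  show ?thesis
    using assms(6,7)
  proof (induction i arbitrary: j)
    \<comment> \<open>Without events nothing can be matched, so \<open>f\<close> itself
      serves.\<close>
    case 0
    have "?d e' f 0 j = ?d e f 0 j"
      by (rule edit_dist_cong) auto
    then show ?case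
      using refl by auto
  next
    case (Suc i)
    note IHi = Suc.IH
    have i: "i < length e"
      using Suc.prems by simp
    from Suc.prems(2) show ?case
    proof (induction j)
      case 0
      have "?d e' f (Suc i) 0 = ?d e f (Suc i) 0"
        by (rule edit_dist_cong) (use Suc.prems(1) PL in auto)
      then show ?case
        using refl by auto
    next
      case (Suc j)
      have j: "j < length f"
        using Suc.prems by simp
      have dest: "?d e' g (Suc i) (Suc j) \<le> ?d e' g i j + P\<^sub>E (e' ! i) (g ! j)"
        "?d e' g (Suc i) (Suc j) \<le> enat (P\<^sub>L (e' ! i)) + ?d e' g i (Suc j)"
        "?d e' g (Suc i) (Suc j) \<le> enat (P\<^sub>M (g ! j)) + ?d e' g (Suc i) j" for g
        by (simp_all add: min.coboundedI2)
      consider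
          (match) "?d e f (Suc i) (Suc j) = ?d e f i j + P\<^sub>E (e ! i) (f ! j)"
        | (log) "?d e f (Suc i) (Suc j) = enat (P\<^sub>L (e ! i)) + ?d e f i (Suc j)"
        | (model) "?d e f (Suc i) (Suc j) = enat (P\<^sub>M (f ! j)) + ?d e f (Suc i) j"
        using Min_in[of "{?d e f i j + P\<^sub>E (e ! i) (f ! j), enat (P\<^sub>L (e ! i)) + ?d e f i (Suc j),
          enat (P\<^sub>M (f ! j)) + ?d e f (Suc i) j}"]
        by (auto simp del: Min_insert)
      then show ?case
      proof cases
        case match
        obtain g where g: "list_all2 (cc_firing N) f g" "?d e' g i j \<le> ?d e f i j"
          using IHi[of j] i j by auto
        \<comment> \<open>The swap starts from \<open>f ! j\<close> and not from
          \<open>g ! j\<close>, because the penalty to be preserved is that of \<open>f ! j\<close>,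
          and the induction hypothesis for the prefixes does not control the penalty of
          \<open>g ! j\<close>.\<close>
        define s where "s = swap_writes N (snd (e ! i)) (snd (e' ! i)) (f ! j)"
        have E: "cc_assign N (snd (e ! i)) (snd (e' ! i))" "fst (e ! i) = fst (e' ! i)"
          using ev[OF i] by (auto simp: cc_event_def)
        have fj: "f ! j \<in> firings N"
          using f j by auto
        have s: "cc_firing N (f ! j) s"
          unfolding s_def
        proof (rule cc_firing_swap_writes[of "fst (e ! i)"])
          show "(fst (e ! i), snd (e ! i)) \<in> events N" "(fst (e ! i), snd (e' ! i)) \<in> events N"
            using ev(1,2)[OF i] unfolding E(2) by (metis prod.collapse E(2))+
        qed (use E fj in auto)
        have g': "list_all2 (cc_firing N) f (g[j := s])"
          using list_all2_update_cong[OF g(1) s, of j] by simp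
        have "P\<^sub>E (e' ! i) s = P\<^sub>E (e ! i) (f ! j)"
        proof (rule D(3)[symmetric])
          show "writes_value N (snd (e ! i)) (f ! j) v \<longleftrightarrow> writes_value N (snd (e' ! i)) s v"
            if "v \<in> dom (snd (e ! i))" for v
            unfolding s_def
            using E(1) that by (intro writes_value_swap_writes[symmetric]) (simp_all add: cc_assign_def)
        qed (use ev[OF i] s in \<open>auto simp: cc_firing_def\<close>)
        \<comment> \<open>Position \<open>j\<close> is the first one beyond the prefix of length
          \<open>j\<close>, so the bound obtained for \<open>g\<close> survives the update.\<close>
        moreover have "?d e' (g[j := s]) i j = ?d e' g i j"
          by (rule edit_dist_cong) auto
        moreover have "j < length g"
          using g(1) j by (simp add: list_all2_lengthD)
        ultimately have "?d e' (g[j := s]) (Suc i) (Suc j) \<le> ?d e' g i j + P\<^sub>E (e ! i) (f ! j)"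
          using dest(1)[of "g[j := s]"] by simp
        also have "\<dots> \<le> ?d e f (Suc i) (Suc j)"
          unfolding match by (rule add_right_mono[OF g(2)])
        finally show ?thesis
          using g' by blast
      next
        case log
        obtain g where g: "list_all2 (cc_firing N) f g" "?d e' g i (Suc j) \<le> ?d e f i (Suc j)"
          using IHi[of "Suc j"] i Suc.prems by auto
        have "?d e' g (Suc i) (Suc j) \<le> ?d e f (Suc i) (Suc j)"
          unfolding log by (rule order_trans[OF dest(2)]) (simp only: PL[OF i] add_left_mono[OF g(2)])
        with g(1) show ?thesis
          by blast
      next
        case model
        obtain g where g: "list_all2 (cc_firing N) f g" "?d e' g (Suc i) j \<le> ?d e f (Suc i) j"
          using Suc.IH j by auto
        have "?d e' g (Suc i) (Suc j) \<le> ?d e f (Suc i) (Suc j)"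
          unfolding model by (rule order_trans[OF dest(3)]) (simp only: PM[OF g(1) j] add_left_mono[OF g(2)])
        with g(1) show ?thesis
          by blast
      qed
    qed
  qed
qed

text \<open>Penalties do not see the values read, so repairing the reads in a replay costs
  nothing.\<close>

lemma distance_same_writes:
  assumes cb: "comparison_based_penalties N P\<^sub>L P\<^sub>M P\<^sub>E"
    and e: "e \<in> log_traces N" and "list_all2 (same_writes N) f g"
  shows "distance P\<^sub>L P\<^sub>M P\<^sub>E e f = distance P\<^sub>L P\<^sub>M P\<^sub>E e g"
proof -
  note D = comparison_based_penaltiesD[OF cb]
  have sw: "same_writes N (f ! l) (g ! l)" if "l < length f" for l
    using list_all2_nthD[OF assms(3) that] .
  have "edit_dist P\<^sub>L P\<^sub>M P\<^sub>E e f (length e) (length f) = edit_dist P\<^sub>L P\<^sub>M P\<^sub>E e g (length e) (length f)"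
  proof (rule edit_dist_cong)
    show "P\<^sub>M (f ! l) = P\<^sub>M (g ! l)" if "l < length f" for l
      using D(2) sw[OF that] unfolding same_writes_def by metis
    show "P\<^sub>E (e ! k) (f ! l) = P\<^sub>E (e ! k) (g ! l)" if "k < length e" "l < length f" for k l
      by (rule D(3)) (use e that sw[OF that(2)] in
          \<open>auto simp: same_writes_def writes_value_def cc_event_refl\<close>)
  qed simp
  then show ?thesis
    using list_all2_lengthD[OF assms(3)] by (simp add: distance_def)
qed


section \<open>Optimal cost\<close>

lemma set_map_filter: "set (List.map_filter h xs) = {y. \<exists>x\<in>set xs. h x = Some y}"
  by (force simp: List.map_filter_def)

lemma model_proj_firings: "\<gamma> \<in> lists (moves N) \<Longrightarrow> model_proj \<gamma> \<in> lists (firings N)"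
  by (force simp: model_proj_def set_map_filter moves_def)

lemma steps_firings: "steps N s fs s' \<Longrightarrow> fs \<in> lists (firings N)"
proof (induction fs arbitrary: s)
  case (Cons f fs)
  then obtain s'' where "step N s f s''" "fs \<in> lists (firings N)"
    by auto
  then show ?case
    by (cases s; cases s''; cases f) auto
qed simp

text \<open>A distance-based cost depends only on the two projections, so any arrangement will do:
  here all events come first, then all firings, with no event paired to a firing.\<close>

lemma complete_alignment_exists:
  assumes "e \<in> log_traces N" "process_run N f"
  obtains \<gamma> where "complete_alignment N e \<gamma>" "model_proj \<gamma> = f"
proof -
  define \<gamma> where "\<gamma> = map (\<lambda>x. (Some x, None)) e @ map (\<lambda>y. (None, Some y)) f"
  have "f \<in> lists (firings N)"
    using assms(2) steps_firings unfolding process_run_def by blast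
  then have "\<gamma> \<in> lists (moves N)"
    using assms(1) by (auto simp: \<gamma>_def moves_def)
  moreover have "log_proj \<gamma> = e" "model_proj \<gamma> = f"
    by (simp_all add: \<gamma>_def log_proj_def model_proj_def List.map_filter_def comp_def)
  ultimately show thesis
    using that assms(2) by (simp add: complete_alignment_def)
qed

lemma opt_cost_cc_le:
  assumes "is_dpn N" "comparison_based N \<kappa>"
    and e: "e \<in> log_traces N" and e': "e' \<in> log_traces N" and cc: "cc_trace N e e'"
  shows "opt_cost N \<kappa> e' \<le> opt_cost N \<kappa> e"
proof -
  obtain P\<^sub>L P\<^sub>M P\<^sub>E where P: "distance_based N P\<^sub>L P\<^sub>M P\<^sub>E \<kappa>" "comparison_based_penalties N P\<^sub>L P\<^sub>M P\<^sub>E"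
    using assms(2) by (auto simp: comparison_based_def)
  have \<kappa>: "\<kappa> \<gamma> = distance P\<^sub>L P\<^sub>M P\<^sub>E x (model_proj \<gamma>)"
    if "x \<in> log_traces N" "complete_alignment N x \<gamma>" for x \<gamma>
    using P(1) that by (auto simp: distance_based_def complete_alignment_def)
  have "\<exists>\<gamma>'. complete_alignment N e' \<gamma>' \<and> \<kappa> \<gamma>' \<le> \<kappa> \<gamma>" if \<gamma>: "complete_alignment N e \<gamma>" for \<gamma>
  proof -
    define f where "f = model_proj \<gamma>"
    have f: "f \<in> lists (firings N)" "process_run N f"
      using \<gamma> model_proj_firings by (auto simp: f_def complete_alignment_def)
    \<comment> \<open>\<open>g\<close> is close enough to \<open>e'\<close> but may fail to be a
      run, as its reads can be stale; \<open>h\<close> below repairs the reads and keeps the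
      writes.\<close>
    obtain g where g: "list_all2 (cc_firing N) f g"
      "edit_dist P\<^sub>L P\<^sub>M P\<^sub>E e' g (length e) (length f) \<le> edit_dist P\<^sub>L P\<^sub>M P\<^sub>E e f (length e) (length f)"
      using cc_trace_edit_dist[OF P(2) cc e e' f(1) order_refl order_refl] by blast
    then have le: "distance P\<^sub>L P\<^sub>M P\<^sub>E e' g \<le> distance P\<^sub>L P\<^sub>M P\<^sub>E e f"
      using cc by (simp add: distance_def cc_trace_def list_all2_lengthD)
    obtain h where h: "list_all2 (same_writes N) g h" "process_run N h"
      using process_run_cc_firing[OF assms(1) f(2) g(1)] .
    obtain \<gamma>' where "complete_alignment N e' \<gamma>'" "model_proj \<gamma>' = h"
      using complete_alignment_exists[OF e' h(2)] .
    then show ?thesis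
      using le distance_same_writes[OF P(2) e' h(1)] \<kappa>[OF e \<gamma>] \<kappa>[OF e', of \<gamma>'] by (auto simp: f_def)
  qed
  then show ?thesis
    unfolding opt_cost_def by (intro INF_mono) simp
qed

theorem theorem2:
  fixes N :: "('n, 'a, 'v, 's) dpn"
    and L :: "('a, 'v, 's) event list multiset"
    and \<kappa> :: "('n, 'a, 'v, 's) move list \<Rightarrow> enat"
  assumes "is_dpn N"
    and "relaxed_data_sound N"
    and "set_mset L \<subseteq> log_traces N"
    and "comparison_based N \<kappa>"
  shows "cost_based_clustering N \<kappa> L (cc_trace N)"
proof -
  have "equiv (set_mset L) {(e, e'). e \<in># L \<and> e' \<in># L \<and> cc_trace N e e'}"
    using equivp_cc_trace[of N]
    by (intro equivI) (auto simp: refl_on_def sym_def trans_def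
        dest: equivp_reflp equivp_symp intro: equivp_transp)
  moreover have "opt_cost N \<kappa> e = opt_cost N \<kappa> e'" if "e \<in># L" "e' \<in># L" "cc_trace N e e'" for e e'
  proof (rule antisym)
    have "e \<in> log_traces N" "e' \<in> log_traces N"
      using assms(3) that(1,2) by auto
    then show "opt_cost N \<kappa> e \<le> opt_cost N \<kappa> e'" "opt_cost N \<kappa> e' \<le> opt_cost N \<kappa> e"
      using opt_cost_cc_le assms(1,4) that(3) cc_trace_sym by blast+
  qed
  ultimately show ?thesis
    by (auto simp: cost_based_clustering_def)
qed

end
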